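(* Let $Q_{A^n}$ be a target probability mass function on $\mathcal{A}^n$, not necessarily a product distribution (i.e., it may have memory). The DM code $\mathcal{S}\subseteq\mathcal{A}^n$ that minimizes $\mathbb{D}(P_{A^n}\|Q_{A^n})$ consists of all sequences $a^n\in\mathcal{A}^n$ which satisfy $$Q_{A^n}(a^n)\ge 2^{-nI}$$ for some $I$. Equivalently, $\mathcal{S}$ consists of all sequences $a^n\in\mathcal{A}^n$ satisfying $$\tfrac1n\, i_{Q_{A^n}}(a^n)\le I.$$
   Context: A (fixed-to-fixed length) distribution matcher (DM) is an invertible mapping $f_{\mathrm{DM}}$ from $k$ bits to $n$ symbols, $a^n=f_{\mathrm{DM}}(b^k)\in\mathcal{A}^n$ for $b^k\in\{0,1\}^k$, where $\mathcal{A}$ is the output alphabet; its purpose is to approximate the target distribution $Q_{A^n}$. The set $\mathcal{S}$ of sequences $a^n=(a_1,\dots,a_n)$ generated by a DM is called its code or codebook. The input bits $B^k$ are uniformly distributed over $\{0,1\}^k$, so each codeword occurs with probability $2^{-k}$; thus $|\mathcal{S}|=2^k$ and the output distribution $P_{A^n}$ is uniform on $\mathcal{S}$. The self-information of $a^n$ with respect to $Q_{A^n}$ is $i_{Q_{A^n}}(a^n)=-\log_2 Q_{A^n}(a^n)$. The divergence is $\mathbb{D}(P\|Q)=\sum_{a\in\mathrm{supp}(P)}P(a)\log_2\frac{P(a)}{Q(a)}$, where $\mathrm{supp}(P)$ is the set of $a$ with $P(a)>0$.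
   Formalization: The exact threshold form is proved when the minimizing code is unique and has finite divergence; tied minimizers only lie between {Q > 2^{-nI}} and {Q ≥ 2^{-nI}}, and a unique minimizer of infinite divergence is all of A^n (no real I). *)

theory Defs
  imports "HOL-Probability.Probability_Mass_Function"
begin

definition words :: "'a set \<Rightarrow> nat \<Rightarrow> 'a list set" where
  "words A n = {xs. set xs \<subseteq> A \<and> length xs = n}"

text \<open>Bits are booleans, so the inputs of a matcher are \<open>words (UNIV :: bool set) k\<close>.\<close>

definition is_dm :: "'a set \<Rightarrow> nat \<Rightarrow> nat \<Rightarrow> (bool list \<Rightarrow> 'a list) \<Rightarrow> bool" where
  "is_dm A n k f \<longleftrightarrow> inj_on f (words UNIV k) \<and> f ` words UNIV k \<subseteq> words A n"

definition dm_code :: "nat \<Rightarrow> (bool list \<Rightarrow> 'a list) \<Rightarrow> 'a list set" where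
  "dm_code k f = f ` words UNIV k"

definition dm_output :: "nat \<Rightarrow> (bool list \<Rightarrow> 'a list) \<Rightarrow> 'a list pmf" where
  "dm_output k f = map_pmf f (pmf_of_set (words UNIV k))"

text \<open>The value is \<open>\<infinity>\<close> as soon as some outcome of \<open>P\<close> has \<open>Q\<close>-probability zero (a real
  \<open>KL_divergence\<close> could not express this). The finite sum is meaningful only for \<open>P\<close> of finite
  support, which is the case for every matcher output.\<close>

definition divergence :: "'b pmf \<Rightarrow> 'b pmf \<Rightarrow> ereal" where
  "divergence P Q =
    (if set_pmf P \<subseteq> set_pmf Q
     then ereal (\<Sum>a\<in>set_pmf P. pmf P a * log 2 (pmf P a / pmf Q a))
     else \<infinity>)"

text \<open>The case distinction is needed because \<open>log 2 0 = 0\<close> in HOL.\<close>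

definition self_information :: "'b pmf \<Rightarrow> 'b \<Rightarrow> ereal" where
  "self_information Q a = (if pmf Q a = 0 then \<infinity> else ereal (- log 2 (pmf Q a)))"

definition optimal_dm ::
  "'a set \<Rightarrow> nat \<Rightarrow> nat \<Rightarrow> 'a list pmf \<Rightarrow> (bool list \<Rightarrow> 'a list) \<Rightarrow> bool" where
  "optimal_dm A n k Q f \<longleftrightarrow>
    is_dm A n k f \<and>
    (\<forall>g. is_dm A n k g \<longrightarrow> divergence (dm_output k f) Q \<le> divergence (dm_output k g) Q)"

text \<open>Many matchers share one code, so uniqueness is a property of the code, not of the map.\<close>

definition uniquely_optimal_dm ::
  "'a set \<Rightarrow> nat \<Rightarrow> nat \<Rightarrow> 'a list pmf \<Rightarrow> (bool list \<Rightarrow> 'a list) \<Rightarrow> bool" where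
  "uniquely_optimal_dm A n k Q f \<longleftrightarrow>
    optimal_dm A n k Q f \<and>
    (\<forall>g. optimal_dm A n k Q g \<longrightarrow> dm_code k g = dm_code k f)"

end

theory Submission imports Defs begin

text \<open>
  A matcher's output is uniform on its code, so up to constants its divergence is minus the sum of
  \<open>log 2 (pmf Q a)\<close> over the code, and is infinite iff the code leaves the support of \<open>Q\<close>. Any set
  of \<open>2 ^ k\<close> words is a code, so optimality is an exchange argument: replacing one codeword by one
  non-codeword cannot pay off iff the code lies between a strict and a weak superlevel set of \<open>Q\<close>.
\<close>

section \<open>Matcher codes as sets of \<open>2 ^ k\<close> words\<close>

lemma finite_words_bool: "finite (words (UNIV :: bool set) k)"
  using finite_lists_length_eq[of "UNIV :: bool set" k] by (simp add: words_def)

lemma card_words_bool: "card (words (UNIV :: bool set) k) = 2 ^ k"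
  using card_lists_length_eq[of "UNIV :: bool set" k] by (simp add: words_def)

lemma words_bool_nonempty: "words (UNIV :: bool set) k \<noteq> {}"
  using card_words_bool[of k] by force

lemma dm_code_props:
  assumes "is_dm A n k f"
  shows "dm_code k f \<subseteq> words A n" "finite (dm_code k f)" "dm_code k f \<noteq> {}"
    "card (dm_code k f) = 2 ^ k"
  using assms finite_words_bool words_bool_nonempty card_words_bool
  by (auto simp: is_dm_def dm_code_def card_image)

text \<open>Any bijection from the bit words onto \<open>C\<close> serves as encoder. This turns
  minimisation over matchers into minimisation over sets of \<open>2 ^ k\<close> words.\<close>

lemma ex_dm_with_code:
  assumes "C \<subseteq> words A n" "card C = 2 ^ k"
  obtains g where "is_dm A n k g" "dm_code k g = C"
proof -
  \<comment> \<open>The alphabet may be infinite, so finiteness comes from the nonzero cardinality: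
    infinite sets have \<open>card\<close> 0.\<close>
  have "finite C"
    using assms(2) by (intro card_ge_0_finite) simp
  then obtain g where "bij_betw g (words UNIV k :: bool list set) C"
    using finite_same_card_bij[OF finite_words_bool] card_words_bool assms(2) by metis
  then show thesis
    using assms(1) by (intro that[of g]) (auto simp: is_dm_def dm_code_def bij_betw_def)
qed

section \<open>Divergence of a matcher output\<close>

lemma dm_output_eq_pmf_of_set:
  assumes "is_dm A n k f"
  shows "dm_output k f = pmf_of_set (dm_code k f)"
  unfolding dm_output_def dm_code_def using assms finite_words_bool words_bool_nonempty
  by (intro map_pmf_of_set_inj) (auto simp: is_dm_def)

text \<open>Every codeword has probability \<open>1 / 2 ^ k\<close>, so each summand splits into a
  constant, whose \<open>2 ^ k\<close> copies add up to \<open>- real k\<close>, and a share of the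
  log sum.\<close>

lemma divergence_dm_output:
  assumes "is_dm A n k f"
  shows "divergence (dm_output k f) Q =
    (if dm_code k f \<subseteq> set_pmf Q
     then ereal (- real k - (\<Sum>a\<in>dm_code k f. log 2 (pmf Q a)) / 2 ^ k) else \<infinity>)"
proof -
  note C = dm_code_props[OF assms]
  have "(\<Sum>a\<in>dm_code k f. 1 / 2 ^ k * log 2 (1 / 2 ^ k / pmf Q a)) =
      - real k - (\<Sum>a\<in>dm_code k f. log 2 (pmf Q a)) / 2 ^ k" if "dm_code k f \<subseteq> set_pmf Q"
  proof -
    have "(\<Sum>a\<in>dm_code k f. 1 / 2 ^ k * log 2 (1 / 2 ^ k / pmf Q a)) =
      (\<Sum>a\<in>dm_code k f. - real k / 2 ^ k - log 2 (pmf Q a) / 2 ^ k)"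
    proof (rule sum.cong)
      fix a assume "a \<in> dm_code k f"
      then have "pmf Q a > 0"
        using that by (auto simp: pmf_positive_iff)
      then have "log 2 (1 / 2 ^ k / pmf Q a) = - real k - log 2 (pmf Q a)"
        by (simp add: log_divide log_mult log_nat_power)
      then show "1 / 2 ^ k * log 2 (1 / 2 ^ k / pmf Q a) =
          - real k / 2 ^ k - log 2 (pmf Q a) / 2 ^ k"
        by (simp add: diff_divide_distrib)
    qed simp
    then show ?thesis
      by (simp add: sum_subtractf sum_divide_distrib C)
  qed
  then show ?thesis
    using C by (simp add: dm_output_eq_pmf_of_set[OF assms] divergence_def)
qed

lemma divergence_dm_output_eq_infinity_iff:
  assumes "is_dm A n k f"
  shows "divergence (dm_output k f) Q = \<infinity> \<longleftrightarrow> \<not> dm_code k f \<subseteq> set_pmf Q"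
  by (simp add: divergence_dm_output[OF assms])

text \<open>The term \<open>- real k\<close> and the factor \<open>1 / 2 ^ k\<close> are common to
  all codes, so only the log sums are left to compare, in reversed order.\<close>

lemma divergence_dm_output_le_iff:
  assumes "is_dm A n k f" "is_dm A n k g"
  shows "divergence (dm_output k f) Q \<le> divergence (dm_output k g) Q \<longleftrightarrow>
    \<not> dm_code k g \<subseteq> set_pmf Q \<or> dm_code k f \<subseteq> set_pmf Q \<and>
    (\<Sum>a\<in>dm_code k g. log 2 (pmf Q a)) \<le> (\<Sum>a\<in>dm_code k f. log 2 (pmf Q a))"
  by (auto simp: divergence_dm_output[OF assms(1)] divergence_dm_output[OF assms(2)]
      divide_le_cancel)

lemma optimal_dm_cong_code:
  assumes "optimal_dm A n k Q f" "is_dm A n k g"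
    "divergence (dm_output k g) Q \<le> divergence (dm_output k f) Q"
  shows "optimal_dm A n k Q g"
  using assms unfolding optimal_dm_def by (meson order_trans)

section \<open>Sums over two sets separated by a threshold\<close>

text \<open>The intersection contributes equally to both sums, and the two differences have the same
  size, so comparing each of their terms with \<open>t\<close> suffices.\<close>

lemma sum_le_sum_threshold:
  fixes h :: "'b \<Rightarrow> real"
  assumes "finite C" "finite C'" "card C' = card C"
    and "\<And>a. a \<in> C - C' \<Longrightarrow> t \<le> h a" "\<And>a. a \<in> C' - C \<Longrightarrow> h a \<le> t"
  shows "sum h C' \<le> sum h C"
proof -
  have "card (C' - C) = card (C - C')"
    using assms(1-3) by (simp add: card_Diff_subset_Int Int_commute)
  then have "sum h (C' - C) \<le> real (card (C - C')) * t"
    using sum_bounded_above[of "C' - C" h t] assms(5) by simp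
  also have "\<dots> \<le> sum h (C - C')"
    using sum_bounded_below[of "C - C'" t h] assms(4) by simp
  finally show ?thesis
    using sum.Int_Diff[OF assms(1), of h C'] sum.Int_Diff[OF assms(2), of h C]
    by (simp add: Int_commute)
qed

lemma sum_less_sum_threshold:
  fixes h :: "'b \<Rightarrow> real"
  assumes "finite C" "finite C'" "card C' = card C" "C' \<noteq> C"
    and "\<And>a. a \<in> C - C' \<Longrightarrow> t \<le> h a" "\<And>a. a \<in> C' - C \<Longrightarrow> h a < t"
  shows "sum h C' < sum h C"
proof -
  have card: "card (C' - C) = card (C - C')"
    using assms(1-3) by (simp add: card_Diff_subset_Int Int_commute)
  \<comment> \<open>Otherwise \<open>C'\<close> would be a subset of \<open>C\<close> of the same
    size, hence equal to it. Nonemptiness makes the next bound strict.\<close>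
  have "C' - C \<noteq> {}"
    using assms(1-4) card_subset_eq[of C C'] by auto
  then have "sum h (C' - C) < real (card (C - C')) * t"
    using sum_bounded_above_strict[of "C' - C" h t] assms(2,6) card
    by (metis card_gt_0_iff finite_Diff)
  also have "\<dots> \<le> sum h (C - C')"
    using sum_bounded_below[of "C - C'" t h] assms(5) by simp
  finally show ?thesis
    using sum.Int_Diff[OF assms(1), of h C'] sum.Int_Diff[OF assms(2), of h C]
    by (simp add: Int_commute)
qed

section \<open>Most probable outcomes of a distribution\<close>

text \<open>More than \<open>1 / t\<close> outcomes of mass at least \<open>t\<close> would exceed
  the total mass 1. This supplies maxima over supports that may be infinite.\<close>

lemma finite_pmf_superlevel:
  assumes "t > 0"
  shows "finite {x. pmf Q x \<ge> t}"
proof (rule ccontr)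
  assume inf: "infinite {x. pmf Q x \<ge> t}"
  obtain m :: nat where m: "1 / t < real m"
    using reals_Archimedean2 by blast
  obtain F where F: "F \<subseteq> {x. pmf Q x \<ge> t}" "finite F" "card F = m"
    using infinite_arbitrarily_large[OF inf] by blast
  have "1 < real m * t"
    using m assms by (simp add: field_simps)
  also have "\<dots> \<le> (\<Sum>x\<in>F. pmf Q x)"
    using sum_bounded_below[of F t "pmf Q"] F by auto
  also have "\<dots> = measure (measure_pmf Q) F"
    by (simp add: measure_measure_pmf_finite F)
  also have "\<dots> \<le> 1"
    by simp
  finally show False
    by simp
qed

text \<open>Greedy choice: repeatedly add a most probable remaining outcome. The set
  \<open>C\<close> certifies that the support is large enough and drives the induction.\<close>

lemma ex_most_probable_subset:
  assumes "finite C" "C \<subseteq> set_pmf Q"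
  shows "\<exists>D \<subseteq> set_pmf Q. finite D \<and> card D = card C \<and>
    (\<forall>a\<in>D. \<forall>b\<in>set_pmf Q - D. pmf Q b \<le> pmf Q a)"
  using assms
proof (induction rule: finite_induct)
  case empty
  then show ?case by (intro exI[of _ "{}"]) auto
next
  case (insert x C)
  then obtain D where D: "D \<subseteq> set_pmf Q" "finite D" "card D = card C"
    and top: "\<And>a b. a \<in> D \<Longrightarrow> b \<in> set_pmf Q - D \<Longrightarrow> pmf Q b \<le> pmf Q a"
    by auto
  have "\<not> insert x C \<subseteq> D"
    using insert.hyps D by (metis card_insert_disjoint card_mono not_less_eq_eq order_refl)
  then obtain b0 where b0: "b0 \<in> set_pmf Q - D"
    using insert.prems by auto
  \<comment> \<open>Outcomes less probable than \<open>b0\<close> cannot be maximal; discarding them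
    leaves a finite set, where a maximum exists.\<close>
  define F where "F = {b \<in> set_pmf Q - D. pmf Q b \<ge> pmf Q b0}"
  have "finite F" "F \<noteq> {}"
    using b0 finite_subset[OF _ finite_pmf_superlevel[of "pmf Q b0" Q], of F]
    by (auto simp: F_def pmf_positive_iff)
  then obtain b where b: "b \<in> F" "\<And>c. c \<in> F \<Longrightarrow> pmf Q c \<le> pmf Q b"
    using arg_min_if_finite(1)[of F "\<lambda>x. - pmf Q x"] arg_min_least[of F _ "\<lambda>x. - pmf Q x"]
    by (metis neg_le_iff_le)
  have b_max: "pmf Q c \<le> pmf Q b" if "c \<in> set_pmf Q - D" for c
  proof (cases "c \<in> F")
    case False
    then have "pmf Q c \<le> pmf Q b0"
      using that by (simp add: F_def)
    also have "\<dots> \<le> pmf Q b"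
      using b(1) by (simp add: F_def)
    finally show ?thesis .
  qed (use b in auto)
  show ?case
  proof (intro exI[of _ "insert b D"] conjI ballI)
    show "card (insert b D) = card (insert x C)"
      using b(1) D insert.hyps by (simp add: F_def)
  qed (use b(1) D top b_max in \<open>auto simp: F_def\<close>)
qed

section \<open>Thresholds and optimal codes\<close>

context
  fixes A :: "'a set" and n k :: nat and Q :: "'a list pmf" and f :: "bool list \<Rightarrow> 'a list"
  assumes dm: "is_dm A n k f"
begin

text \<open>Codewords missing from a competing code have probability at least \<open>t\<close>, and
  those it adds at most \<open>t\<close>. Words of probability exactly \<open>t\<close> may lie on
  either side.\<close>

lemma optimal_dm_of_threshold:
  assumes "t > 0" and above: "{a \<in> words A n. pmf Q a > t} \<subseteq> dm_code k f"
    and below: "dm_code k f \<subseteq> {a \<in> words A n. pmf Q a \<ge> t}"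
  shows "optimal_dm A n k Q f"
  unfolding optimal_dm_def
proof (intro conjI allI impI dm)
  fix g assume g: "is_dm A n k g"
  note F = dm_code_props[OF dm] and G = dm_code_props[OF g]
  have "dm_code k f \<subseteq> set_pmf Q"
    using below \<open>t > 0\<close> by (force simp: pmf_positive_iff[symmetric])
  moreover have "(\<Sum>a\<in>dm_code k g. log 2 (pmf Q a)) \<le> (\<Sum>a\<in>dm_code k f. log 2 (pmf Q a))"
    if "dm_code k g \<subseteq> set_pmf Q"
  proof (rule sum_le_sum_threshold[where t = "log 2 t"])
    fix a assume "a \<in> dm_code k f - dm_code k g"
    then show "log 2 t \<le> log 2 (pmf Q a)"
      using below \<open>t > 0\<close> by auto
  next
    fix a assume a: "a \<in> dm_code k g - dm_code k f"
    \<comment> \<open>Positivity matters: as \<open>log 2 0 = 0\<close>, a word outside the support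
      could break the bound by \<open>log 2 t\<close>.\<close>
    then have "0 < pmf Q a" "pmf Q a \<le> t"
      using above G(1) that by (force simp: pmf_positive_iff)+
    then show "log 2 (pmf Q a) \<le> log 2 t"
      by simp
  qed (use F G in auto)
  ultimately show "divergence (dm_output k f) Q \<le> divergence (dm_output k g) Q"
    by (auto simp: divergence_dm_output_le_iff[OF dm g])
qed

text \<open>Here all ties at \<open>t\<close> are inside the code, so every word outside is strictly
  less probable and any other code has a strictly smaller log sum.\<close>

lemma uniquely_optimal_dm_of_superlevel:
  assumes "t > 0" and code: "dm_code k f = {a \<in> words A n. pmf Q a \<ge> t}"
  shows "uniquely_optimal_dm A n k Q f"
  unfolding uniquely_optimal_dm_def
proof (intro conjI allI impI)
  show "optimal_dm A n k Q f"
    by (rule optimal_dm_of_threshold[OF \<open>t > 0\<close>]) (simp_all add: code subset_eq)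
next
  fix g assume "optimal_dm A n k Q g"
  then have g: "is_dm A n k g" and
    le: "divergence (dm_output k g) Q \<le> divergence (dm_output k f) Q"
    using dm by (auto simp: optimal_dm_def)
  note F = dm_code_props[OF dm] and G = dm_code_props[OF g]
  have "dm_code k f \<subseteq> set_pmf Q"
    using code \<open>t > 0\<close> by (force simp: pmf_positive_iff[symmetric])
  \<comment> \<open>The divergence of \<open>f\<close> is finite, so an optimal \<open>g\<close>
    must stay in the support too.\<close>
  with le have sub: "dm_code k g \<subseteq> set_pmf Q" and
    sum_le: "(\<Sum>a\<in>dm_code k f. log 2 (pmf Q a)) \<le> (\<Sum>a\<in>dm_code k g. log 2 (pmf Q a))"
    by (auto simp: divergence_dm_output_le_iff[OF g dm])
  show "dm_code k g = dm_code k f"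
  proof (rule ccontr)
    assume "dm_code k g \<noteq> dm_code k f"
    then have "(\<Sum>a\<in>dm_code k g. log 2 (pmf Q a)) < (\<Sum>a\<in>dm_code k f. log 2 (pmf Q a))"
    proof (rule sum_less_sum_threshold[where t = "log 2 t", rotated 3])
      fix a assume "a \<in> dm_code k f - dm_code k g"
      then show "log 2 t \<le> log 2 (pmf Q a)"
        using code \<open>t > 0\<close> by auto
    next
      fix a assume a: "a \<in> dm_code k g - dm_code k f"
      then have "0 < pmf Q a" "pmf Q a < t"
        using code G(1) sub by (force simp: pmf_positive_iff)+
      then show "log 2 (pmf Q a) < log 2 t"
        by simp
    qed (use F G in auto)
    with sum_le show False
      by simp
  qed
qed

text \<open>Swapping \<open>a\<close> for \<open>b\<close> raises the log sum by
  \<open>log 2 (pmf Q b) - log 2 (pmf Q a)\<close>. The last clause separates a strict gain, which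
  refutes optimality, from a tie, which refutes uniqueness.\<close>

lemma exchange_codeword:
  assumes "dm_code k f \<subseteq> set_pmf Q" "a \<in> dm_code k f" "b \<in> words A n - dm_code k f"
    and "pmf Q a \<le> pmf Q b"
  obtains g where "is_dm A n k g" "dm_code k g \<noteq> dm_code k f"
    "divergence (dm_output k g) Q \<le> divergence (dm_output k f) Q"
    "divergence (dm_output k f) Q \<le> divergence (dm_output k g) Q \<longleftrightarrow> pmf Q a = pmf Q b"
proof -
  note F = dm_code_props[OF dm]
  let ?C = "insert b (dm_code k f - {a})"
  have "pmf Q a > 0"
    using assms(1,2) by (auto simp: pmf_positive_iff)
  then have pos: "pmf Q a > 0" "pmf Q b > 0"
    using assms(4) by auto
  have "?C \<subseteq> words A n" "card ?C = 2 ^ k"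
    using assms(2,3) F by auto
  then obtain g where g: "is_dm A n k g" "dm_code k g = ?C"
    by (rule ex_dm_with_code)
  have sub: "?C \<subseteq> set_pmf Q"
    using assms(1) pos by (auto simp: pmf_positive_iff)
  have "(\<Sum>x\<in>?C. log 2 (pmf Q x)) =
      (\<Sum>x\<in>dm_code k f. log 2 (pmf Q x)) - log 2 (pmf Q a) + log 2 (pmf Q b)"
    using assms(2,3) F by (simp add: sum_diff1)
  moreover have "log 2 (pmf Q b) \<le> log 2 (pmf Q a) \<longleftrightarrow> pmf Q a = pmf Q b"
    "log 2 (pmf Q a) \<le> log 2 (pmf Q b)"
    using pos assms(4) by auto
  ultimately show thesis
    using assms(1,3) sub g(2) that[OF g(1)]
    by (auto simp: divergence_dm_output_le_iff[OF g(1) dm] divergence_dm_output_le_iff[OF dm g(1)])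
qed

text \<open>The threshold is the least probability of a codeword: a more probable word outside could
  be exchanged with gain, and an equally probable one would yield a second optimal code.\<close>

lemma threshold_of_optimal_dm:
  assumes "optimal_dm A n k Q f" "dm_code k f \<subseteq> set_pmf Q"
  obtains t where "t > 0" "{a \<in> words A n. pmf Q a > t} \<subseteq> dm_code k f"
    "dm_code k f \<subseteq> {a \<in> words A n. pmf Q a \<ge> t}"
    "uniquely_optimal_dm A n k Q f \<longrightarrow> dm_code k f = {a \<in> words A n. pmf Q a \<ge> t}"
proof -
  note F = dm_code_props[OF dm]
  obtain a where a: "a \<in> dm_code k f" "\<And>b. b \<in> dm_code k f \<Longrightarrow> pmf Q a \<le> pmf Q b"
    using arg_min_if_finite(1)[OF F(2,3)] arg_min_least[OF F(2,3)] by blast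
  have above: "pmf Q b \<le> pmf Q a \<and> (uniquely_optimal_dm A n k Q f \<longrightarrow> pmf Q b < pmf Q a)"
    if b: "b \<in> words A n - dm_code k f" for b
  proof (cases "pmf Q a \<le> pmf Q b")
    case True
    obtain g where g: "is_dm A n k g" "dm_code k g \<noteq> dm_code k f"
      "divergence (dm_output k g) Q \<le> divergence (dm_output k f) Q"
      "divergence (dm_output k f) Q \<le> divergence (dm_output k g) Q \<longleftrightarrow> pmf Q a = pmf Q b"
      using exchange_codeword[OF assms(2) a(1) b True] by blast
    \<comment> \<open>Optimality of \<open>f\<close> rules out a strict gain.\<close>
    have "pmf Q a = pmf Q b"
      using g(1,4) assms(1) by (auto simp: optimal_dm_def)
    moreover have "\<not> uniquely_optimal_dm A n k Q f"
      using optimal_dm_cong_code[OF assms(1) g(1,3)] g(2) by (auto simp: uniquely_optimal_dm_def)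
    ultimately show ?thesis
      by simp
  qed auto
  show thesis
  proof (rule that[of "pmf Q a"])
    show "pmf Q a > 0"
      using a(1) assms(2) by (auto simp: pmf_positive_iff)
  qed (use above a F(1) in force)+
qed

text \<open>If the optimum is infinite, every matcher attains it; any word outside the code could
  then be swapped in, giving another optimal code.\<close>

lemma code_eq_words_of_uniquely_optimal_dm:
  assumes "uniquely_optimal_dm A n k Q f" "\<not> dm_code k f \<subseteq> set_pmf Q"
  shows "dm_code k f = words A n"
proof (rule ccontr)
  note F = dm_code_props[OF dm]
  assume "dm_code k f \<noteq> words A n"
  then obtain b where b: "b \<in> words A n - dm_code k f"
    using F(1) by auto
  obtain a where a: "a \<in> dm_code k f"
    using F(3) by auto
  let ?C = "insert b (dm_code k f - {a})"
  have "?C \<subseteq> words A n" "card ?C = 2 ^ k"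
    using a b F by auto
  then obtain g where g: "is_dm A n k g" "dm_code k g = ?C"
    by (rule ex_dm_with_code)
  have "optimal_dm A n k Q g"
  proof (rule optimal_dm_cong_code[OF _ g(1)])
    show "optimal_dm A n k Q f"
      using assms(1) unfolding uniquely_optimal_dm_def by blast
    show "divergence (dm_output k g) Q \<le> divergence (dm_output k f) Q"
      using assms(2) by (simp add: divergence_dm_output_le_iff[OF g(1) dm])
  qed
  then have "dm_code k g = dm_code k f"
    using assms(1) unfolding uniquely_optimal_dm_def by blast
  then show False
    using g(2) b by auto
qed

end

section \<open>Existence of an optimal matcher\<close>

text \<open>There may be infinitely many codes, so a minimiser is constructed. If no code fits in
  the support, all divergences are infinite; otherwise the \<open>2 ^ k\<close> most probable words
  form an optimal code.\<close>

lemma ex_optimal_dm: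
  assumes dm: "is_dm A n k f" and "set_pmf Q \<subseteq> words A n"
  shows "\<exists>g. optimal_dm A n k Q g"
proof (cases "\<exists>g. is_dm A n k g \<and> dm_code k g \<subseteq> set_pmf Q")
  case False
  then have "optimal_dm A n k Q f"
    using dm by (auto simp: optimal_dm_def divergence_dm_output_le_iff)
  then show ?thesis by blast
next
  case True
  then obtain g where g: "is_dm A n k g" "dm_code k g \<subseteq> set_pmf Q"
    by blast
  note G = dm_code_props[OF g(1)]
  \<comment> \<open>The code of \<open>g\<close> shows that the support has at least
    \<open>2 ^ k\<close> words.\<close>
  obtain D where D: "D \<subseteq> set_pmf Q" "finite D" "card D = 2 ^ k"
    and top: "\<And>a b. a \<in> D \<Longrightarrow> b \<in> set_pmf Q - D \<Longrightarrow> pmf Q b \<le> pmf Q a"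
    using ex_most_probable_subset[OF G(2) g(2)] G(4) by auto
  obtain h where h: "is_dm A n k h" "dm_code k h = D"
    using ex_dm_with_code[of D A n k] D assms(2) by auto
  note H = dm_code_props[OF h(1)]
  obtain a where a: "a \<in> D" "\<And>b. b \<in> D \<Longrightarrow> pmf Q a \<le> pmf Q b"
    using arg_min_if_finite(1)[OF H(2,3)] arg_min_least[OF H(2,3)] h(2) by blast
  have "0 < pmf Q a"
    using a(1) D(1) by (auto simp: pmf_positive_iff)
  moreover have "b \<in> D" if "pmf Q b > pmf Q a" for b
  proof (rule ccontr)
    assume "b \<notin> D"
    \<comment> \<open>\<open>top\<close> ranks only words of the support; exceeding a positive
      probability puts \<open>b\<close> there.\<close>
    moreover have "b \<in> set_pmf Q"
      using that \<open>0 < pmf Q a\<close> by (simp add: pmf_positive_iff[symmetric])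
    ultimately show False
      using top[OF a(1), of b] that by auto
  qed
  ultimately show ?thesis
    using optimal_dm_of_threshold[OF h(1), of "pmf Q a" Q] a(2) H(1) h(2) by blast
qed

section \<open>Exponents and self-information\<close>

text \<open>For \<open>n \<ge> 1\<close> the values \<open>2 powr (- (real n * I))\<close> are
  exactly the positive reals, with inverse \<open>- log 2 t / real n\<close>.\<close>

lemma ex_exponent_iff_ex_threshold:
  assumes "n \<ge> 1"
  shows "(\<exists>I::real. P (2 powr (- (real n * I)))) \<longleftrightarrow> (\<exists>t>0. P t)"
proof
  assume "\<exists>t>0. P t"
  then obtain t where t: "t > 0" "P t" by blast
  have "2 powr (- (real n * (- log 2 t / real n))) = t"
    using t(1) assms by (simp add: powr_log_cancel)
  then show "\<exists>I. P (2 powr (- (real n * I)))"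
    using t(2) by metis
next
  assume "\<exists>I::real. P (2 powr (- (real n * I)))"
  then show "\<exists>t>0. P t"
    by (metis powr_gt_zero zero_neq_numeral)
qed

text \<open>Take logarithms. A word of probability zero fails both conditions: its self-information
  is infinite, and the power of 2 is positive.\<close>

lemma self_information_le_iff:
  assumes "n \<ge> 1"
  shows "ereal (1 / real n) * self_information Q a \<le> ereal I \<longleftrightarrow>
    pmf Q a \<ge> 2 powr (- (real n * I))"
proof (cases "pmf Q a = 0")
  case True
  then show ?thesis
    using assms by (simp add: self_information_def not_le)
next
  case False
  then have "pmf Q a > 0"
    by (simp add: pmf_positive_iff set_pmf_iff)
  then have "2 powr (- (real n * I)) \<le> pmf Q a \<longleftrightarrow> - (real n * I) \<le> log 2 (pmf Q a)"
    by (simp add: le_log_iff)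
  also have "\<dots> \<longleftrightarrow> 1 / real n * (- log 2 (pmf Q a)) \<le> I"
    using assms by (simp add: field_simps) linarith
  finally show ?thesis
    using False by (simp add: self_information_def)
qed

text \<open>Ties in \<open>Q\<close> at the cut-off can leave several codes optimal: an exact
  superlevel set captures the unique optimum, a sandwich the general one. No superlevel set at a
  positive level contains a word of probability zero, so infinite divergence is a separate
  case.\<close>

theorem theorem1:
  fixes A :: "'a set" and n k :: nat and Q :: "'a list pmf" and f :: "bool list \<Rightarrow> 'a list"
  assumes "n \<ge> 1"
    and "set_pmf Q \<subseteq> words A n"
    and "is_dm A n k f"
  shows "(\<exists>g. optimal_dm A n k Q g) \<and>
    (uniquely_optimal_dm A n k Q f \<and> divergence (dm_output k f) Q \<noteq> \<infinity> \<longleftrightarrow>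
      (\<exists>I::real. dm_code k f = {a \<in> words A n. pmf Q a \<ge> 2 powr (- (real n * I))})) \<and>
    (uniquely_optimal_dm A n k Q f \<and> divergence (dm_output k f) Q = \<infinity> \<longrightarrow>
      dm_code k f = words A n) \<and>
    (optimal_dm A n k Q f \<and> divergence (dm_output k f) Q \<noteq> \<infinity> \<longleftrightarrow>
      (\<exists>I::real. {a \<in> words A n. pmf Q a > 2 powr (- (real n * I))} \<subseteq> dm_code k f \<and>
                 dm_code k f \<subseteq> {a \<in> words A n. pmf Q a \<ge> 2 powr (- (real n * I))})) \<and>
    (\<forall>I::real. {a \<in> words A n. pmf Q a \<ge> 2 powr (- (real n * I))} =
               {a \<in> words A n. ereal (1 / real n) * self_information Q a \<le> ereal I})"
proof -
  note n = assms(1) and dm = assms(3)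
  \<comment> \<open>A positive threshold excludes words of probability zero, which makes the
    divergence finite.\<close>
  have supp: "dm_code k f \<subseteq> set_pmf Q" if "t > 0" "dm_code k f \<subseteq> {a \<in> words A n. pmf Q a \<ge> t}" for t
    using that by (force simp: pmf_positive_iff[symmetric])
  have unique: "uniquely_optimal_dm A n k Q f \<and> divergence (dm_output k f) Q \<noteq> \<infinity> \<longleftrightarrow>
      (\<exists>t>0. dm_code k f = {a \<in> words A n. pmf Q a \<ge> t})"
    (is "?L \<longleftrightarrow> ?R")
  proof
    assume ?L
    then have "optimal_dm A n k Q f" "dm_code k f \<subseteq> set_pmf Q"
      unfolding uniquely_optimal_dm_def divergence_dm_output_eq_infinity_iff[OF dm] by blast+
    then obtain t where "t > 0"
      "uniquely_optimal_dm A n k Q f \<longrightarrow> dm_code k f = {a \<in> words A n. pmf Q a \<ge> t}"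
      by (rule threshold_of_optimal_dm[OF dm]) blast
    then show ?R
      using \<open>?L\<close> by blast
  next
    assume ?R
    then obtain t where "t > 0" "dm_code k f = {a \<in> words A n. pmf Q a \<ge> t}"
      by blast
    then show ?L
      using uniquely_optimal_dm_of_superlevel[OF dm, of t Q] supp[of t]
      by (simp add: divergence_dm_output_eq_infinity_iff[OF dm])
  qed
  have optimal: "optimal_dm A n k Q f \<and> divergence (dm_output k f) Q \<noteq> \<infinity> \<longleftrightarrow>
      (\<exists>t>0. {a \<in> words A n. pmf Q a > t} \<subseteq> dm_code k f \<and>
        dm_code k f \<subseteq> {a \<in> words A n. pmf Q a \<ge> t})"
    (is "?L \<longleftrightarrow> ?R")
  proof
    assume ?L
    then have "optimal_dm A n k Q f" "dm_code k f \<subseteq> set_pmf Q"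
      by (simp_all add: divergence_dm_output_eq_infinity_iff[OF dm])
    then obtain t where "t > 0" "{a \<in> words A n. pmf Q a > t} \<subseteq> dm_code k f"
      "dm_code k f \<subseteq> {a \<in> words A n. pmf Q a \<ge> t}"
      by (rule threshold_of_optimal_dm[OF dm]) blast
    then show ?R
      by blast
  next
    assume ?R
    then obtain t where t: "t > 0" "{a \<in> words A n. pmf Q a > t} \<subseteq> dm_code k f"
      "dm_code k f \<subseteq> {a \<in> words A n. pmf Q a \<ge> t}"
      by blast
    then show ?L
      using optimal_dm_of_threshold[OF dm t] supp[OF t(1,3)]
      by (simp add: divergence_dm_output_eq_infinity_iff[OF dm])
  qed
  show ?thesis
    unfolding unique optimal self_information_le_iff[OF n]
      ex_exponent_iff_ex_threshold[OF n, of "\<lambda>t. dm_code k f = {a \<in> words A n. pmf Q a \<ge> t}"]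
      ex_exponent_iff_ex_threshold[OF n, of "\<lambda>t. {a \<in> words A n. pmf Q a > t} \<subseteq> dm_code k f \<and>
        dm_code k f \<subseteq> {a \<in> words A n. pmf Q a \<ge> t}"]
    using ex_optimal_dm[OF dm assms(2)] code_eq_words_of_uniquely_optimal_dm[OF dm, of Q]
    by (simp add: divergence_dm_output_eq_infinity_iff[OF dm])
qed

end
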